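(* Let $\Omega\subset\mathbb R^n$ be a Borel set and let $f_k\rightharpoonup f$ weakly in $L^\infty(\Omega)$. Then $$\mathrm{pr}f(x)=\lim_{k\to\infty}\mathrm{pr}f_k(x)\qquad\text{for all }x\in\hat\Omega ,$$ where $\mathrm{pr}f(x)$ and $\mathrm{pr}f_k(x)$ have to be related to the same $\mathcal L^n$-density $\mathrm{dens}_x^\Omega$ which, however, can be chosen arbitrarily in $\mathcal L^n\text{-}\mathrm{Dens}_x^\Omega$. Moreover, let $\Omega_0\subset\hat\Omega$ be the $\mathcal L^n$-null set of all $x$ where $f^\star(x)$ and $f_k^\star(x)$ do not exist as limit for almost all $f_k$. Then $$f^\star(x)=\lim_{k\to\infty}f_k^\star(x)\qquad\text{for }\mathcal L^n\text{-a.e. }x\in\hat\Omega\setminus\Omega_0 .$$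
   Context: $\mathcal L^n$ is Lebesgue measure, $\mathcal B(\Omega)$ the Borel subsets of $\Omega$. $\mathrm{ba}(\Omega,\mathcal B(\Omega),\mathcal L^n)$ is the space of bounded finitely additive set functions $\mu:\mathcal B(\Omega)\to\mathbb R$ with $\mu(A)=0$ whenever $\mathcal L^n(A)=0$. It is the dual of $L^\infty(\Omega)$ (classes of $\mathcal L^n$-essentially bounded functions) via $\langle\mu,f\rangle=\int_\Omega f\,d\mu$ (integral of Borel step functions extended by uniform approximation); thus $f_k\rightharpoonup f$ means $\int_\Omega f_k\,d\mu\to\int_\Omega f\,d\mu$ for all such $\mu$. $\hat\Omega:=\{x\in\overline\Omega:\mathcal L^n(\Omega\cap B_\delta(x))>0\text{ for all }\delta>0\}$, where $\overline\Omega$ is the closure of $\Omega$ in $\mathbb R^n$. For $x\in\hat\Omega$, $\mathcal L^n\text{-}\mathrm{Dens}_x^\Omega$ is the (nonempty) set of all $\mu\in\mathrm{ba}(\Omega,\mathcal B(\Omega),\mathcal L^n)$ with $$\liminf_{\delta\downarrow0}\frac{\mathcal L^n(A\cap\Omega\cap B_\delta(x))}{\mathcal L^n(\Omega\cap B_\delta(x))}\le\mu(A)\le\limsup_{\delta\downarrow0}\frac{\mathcal L^n(A\cap\Omega\cap B_\delta(x))}{\mathcal L^n(\Omega\cap B_\delta(x))}\quad\text{for all }A\in\mathcal B(\Omega);$$ its elements are called $\mathcal L^n$-densities at $x$ within $\Omega$. For $g\in L^\infty(\Omega)$ and $x\in\hat\Omega$, $\mathrm{pr}g(x):=\int_\Omega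 g\,d\,\mathrm{dens}_x^\Omega$ for a chosen $\mathrm{dens}_x^\Omega\in\mathcal L^n\text{-}\mathrm{Dens}_x^\Omega$. Further $g^\star(x):=\lim_{\delta\downarrow0}\frac1{\mathcal L^n(B_\delta(x)\cap\Omega)}\int_{B_\delta(x)\cap\Omega}g\,d\mathcal L^n$ if this limit exists (then "$g^\star(x)$ exists as limit"), and $g^\star(x):=0$ otherwise.
   Formalization: The set Ω_0 need not be null when Ω̂∖Ω has positive measure; proved instead is that Ω_0∩Ω is null, and Ω_0 is the set where f* or infinitely many f_k* fail to exist as limit. *)

theory Defs
  imports "HOL-Analysis.Analysis"
begin

abbreviation borel_subsets :: "'a::euclidean_space set \<Rightarrow> 'a set set" where
  "borel_subsets \<Omega> \<equiv> sets (restrict_space borel \<Omega>)"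

text \<open>Elements of \<open>L\<^sup>\<infinity>(\<Omega>)\<close> are given by representatives. Only values on \<open>\<Omega>\<close> are relevant, and
  every notion below is unchanged when a representative is modified on a null set.\<close>

definition Linf :: "'a::euclidean_space set \<Rightarrow> ('a \<Rightarrow> real) set" where
  "Linf \<Omega> = {f \<in> borel_measurable (lebesgue_on \<Omega>). \<exists>C. AE x in lebesgue_on \<Omega>. \<bar>f x\<bar> \<le> C}"

text \<open>The space \<open>ba(\<Omega>, \<B>(\<Omega>), \<L>\<^sup>n)\<close>; the values of a set function outside \<open>\<B>(\<Omega>)\<close> are
  irrelevant.\<close>

definition ba :: "'a::euclidean_space set \<Rightarrow> ('a set \<Rightarrow> real) set" where
  "ba \<Omega> = {\<mu>. additive (borel_subsets \<Omega>) \<mu> \<and> bounded (\<mu> ` borel_subsets \<Omega>) \<and>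
               (\<forall>A\<in>borel_subsets \<Omega>. emeasure lebesgue A = 0 \<longrightarrow> \<mu> A = 0)}"

definition ba_step_integral ::
    "'a::euclidean_space set \<Rightarrow> ('a set \<Rightarrow> real) \<Rightarrow> ('a \<Rightarrow> real) \<Rightarrow> real" where
  "ba_step_integral \<Omega> \<mu> s = (\<Sum>y\<in>s ` \<Omega>. y * \<mu> (s -` {y} \<inter> \<Omega>))"

text \<open>Extension from Borel step functions by approximation that is uniform up to null sets,
  that is, uniform for the norm of \<open>L\<^sup>\<infinity>(\<Omega>)\<close>.\<close>

definition has_ba_integral ::
    "'a::euclidean_space set \<Rightarrow> ('a set \<Rightarrow> real) \<Rightarrow> ('a \<Rightarrow> real) \<Rightarrow> real \<Rightarrow> bool" where
  "has_ba_integral \<Omega> \<mu> f I \<longleftrightarrow>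
     (\<exists>s :: nat \<Rightarrow> 'a \<Rightarrow> real.
        (\<forall>k. simple_function (restrict_space borel \<Omega>) (s k)) \<and>
        (\<forall>e>0. \<forall>\<^sub>F k in sequentially. AE x in lebesgue_on \<Omega>. \<bar>s k x - f x\<bar> \<le> e) \<and>
        (\<lambda>k. ba_step_integral \<Omega> \<mu> (s k)) \<longlonglongrightarrow> I)"

definition ba_integral ::
    "'a::euclidean_space set \<Rightarrow> ('a set \<Rightarrow> real) \<Rightarrow> ('a \<Rightarrow> real) \<Rightarrow> real" where
  "ba_integral \<Omega> \<mu> f = (THE I. has_ba_integral \<Omega> \<mu> f I)"

definition Linf_weakly_converges ::
    "'a::euclidean_space set \<Rightarrow> (nat \<Rightarrow> 'a \<Rightarrow> real) \<Rightarrow> ('a \<Rightarrow> real) \<Rightarrow> bool" where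
  "Linf_weakly_converges \<Omega> fs f \<longleftrightarrow>
     (\<forall>k. fs k \<in> Linf \<Omega>) \<and> f \<in> Linf \<Omega> \<and>
     (\<forall>\<mu>\<in>ba \<Omega>. (\<lambda>k. ba_integral \<Omega> \<mu> (fs k)) \<longlonglongrightarrow> ba_integral \<Omega> \<mu> f)"

definition Omega_hat :: "'a::euclidean_space set \<Rightarrow> 'a set" where
  "Omega_hat \<Omega> = {x \<in> closure \<Omega>. \<forall>\<delta>>0. emeasure lebesgue (\<Omega> \<inter> ball x \<delta>) > 0}"

definition rel_density :: "'a::euclidean_space set \<Rightarrow> 'a \<Rightarrow> 'a set \<Rightarrow> real \<Rightarrow> real" where
  "rel_density \<Omega> x A \<delta> = measure lebesgue (A \<inter> \<Omega> \<inter> ball x \<delta>) / measure lebesgue (\<Omega> \<inter> ball x \<delta>)"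

definition Dens :: "'a::euclidean_space set \<Rightarrow> 'a \<Rightarrow> ('a set \<Rightarrow> real) set" where
  "Dens \<Omega> x = {\<mu> \<in> ba \<Omega>. \<forall>A\<in>borel_subsets \<Omega>.
      Liminf (at_right 0) (\<lambda>\<delta>. ereal (rel_density \<Omega> x A \<delta>)) \<le> ereal (\<mu> A) \<and>
      ereal (\<mu> A) \<le> Limsup (at_right 0) (\<lambda>\<delta>. ereal (rel_density \<Omega> x A \<delta>))}"

text \<open>The argument \<open>dens\<close> is the choice \<open>x \<mapsto> dens\<^sub>x\<close> on which \<open>pr g\<close> depends.\<close>

definition pr ::
    "'a::euclidean_space set \<Rightarrow> ('a \<Rightarrow> 'a set \<Rightarrow> real) \<Rightarrow> ('a \<Rightarrow> real) \<Rightarrow> 'a \<Rightarrow> real" where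
  "pr \<Omega> dens g x = ba_integral \<Omega> (dens x) g"

definition ball_avg :: "'a::euclidean_space set \<Rightarrow> ('a \<Rightarrow> real) \<Rightarrow> 'a \<Rightarrow> real \<Rightarrow> real" where
  "ball_avg \<Omega> g x \<delta> =
     (LINT y|lebesgue_on (ball x \<delta> \<inter> \<Omega>). g y) / measure lebesgue (ball x \<delta> \<inter> \<Omega>)"

definition star_exists :: "'a::euclidean_space set \<Rightarrow> ('a \<Rightarrow> real) \<Rightarrow> 'a \<Rightarrow> bool" where
  "star_exists \<Omega> g x \<longleftrightarrow> (\<exists>l. (ball_avg \<Omega> g x \<longlongrightarrow> l) (at_right 0))"

definition star :: "'a::euclidean_space set \<Rightarrow> ('a \<Rightarrow> real) \<Rightarrow> 'a \<Rightarrow> real" where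
  "star \<Omega> g x = (if star_exists \<Omega> g x then Lim (at_right 0) (ball_avg \<Omega> g x) else 0)"

text \<open>The points of \<open>Omega_hat \<Omega>\<close> where it fails that \<open>f\<^sup>\<star>\<close> and \<open>f\<^sub>k\<^sup>\<star>\<close>, for all but finitely many
  \<open>k\<close>, exist as limit. Lebesgue differentiation makes its part inside \<open>\<Omega>\<close> a null set; the part in
  \<open>Omega_hat \<Omega> - \<Omega>\<close> need not be null when this difference has positive measure.\<close>

definition Omega_zero ::
    "'a::euclidean_space set \<Rightarrow> (nat \<Rightarrow> 'a \<Rightarrow> real) \<Rightarrow> ('a \<Rightarrow> real) \<Rightarrow> 'a set" where
  "Omega_zero \<Omega> fs f = {x \<in> Omega_hat \<Omega>.
     \<not> (star_exists \<Omega> f x \<and> (\<forall>\<^sub>F k in sequentially. star_exists \<Omega> (fs k) x))}"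

end

theory Submission
  imports Defs
begin

text \<open>
  The first claim is the definition of weak convergence, tested with the density itself. That
  \<open>f\<^sup>\<star>\<close> and \<open>f\<^sub>k\<^sup>\<star>\<close> exist almost everywhere in \<open>\<Omega>\<close> follows from the Lebesgue density theorem (a
  consequence of Vitali's covering theorem), applied to the countably many level sets of step
  functions that approximate \<open>f\<close> and \<open>f\<^sub>k\<close> uniformly.

  For the last claim, fix \<open>x\<close> in \<open>Omega_hat \<Omega>\<close>. By Tychonoff, the set functions
  \<open>A \<mapsto> rel_density \<Omega> x A \<delta>\<close> have a cluster point \<open>\<mu>\<close> as \<open>\<delta> \<down> 0\<close>. It belongs to \<open>ba \<Omega>\<close>, and
  \<open>\<integral> g d\<mu> = g\<^sup>\<star>(x)\<close> whenever \<open>g\<^sup>\<star>(x)\<close> exists as limit. Testing weak convergence with this \<open>\<mu>\<close>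
  gives the convergence at every point of \<open>Omega_hat \<Omega> - Omega_zero \<Omega> fs f\<close>.
\<close>

section \<open>Vitali coverings and the Lebesgue density theorem\<close>

lemma measure_le_fmeasurable:
  assumes "A \<subseteq> B" "B \<in> fmeasurable M"
  shows "measure M A \<le> measure M B"
  using assms by (cases "A \<in> sets M") (auto simp: measure_notin_sets intro: measure_mono_fmeasurable)

lemma Int_ball_lmeasurable:
  "A \<in> sets lebesgue \<Longrightarrow> A \<inter> ball x d \<in> lmeasurable"
  by (metis fmeasurable_Int_fmeasurable inf_commute lmeasurable_ball)

lemma ball_Int_lmeasurable:
  "A \<in> sets lebesgue \<Longrightarrow> ball x d \<inter> A \<in> lmeasurable"
  by (metis Int_ball_lmeasurable inf_commute)

text \<open>By Vitali's theorem, disjoint small balls inside \<open>T\<close> cover \<open>S\<close>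
  up to a negligible set. Replacing each ball by its cover \<open>U\<close> loses no point of
  \<open>S\<close> there and scales the total measure by at most \<open>c\<close>. The covers
  \<open>U\<close> stand in for the intersections with \<open>S\<close>, which may fail to be
  measurable.\<close>

lemma outer_measure_shrinks:
  fixes S :: "'a::euclidean_space set"
  assumes T: "open T" "T \<in> lmeasurable" "S \<subseteq> T" and "0 < c"
    and dens: "\<And>x e. x \<in> S \<Longrightarrow> e > 0 \<Longrightarrow> \<exists>d U. 0 < d \<and> d < e \<and> S \<inter> ball x d \<subseteq> U \<and> U \<in> lmeasurable \<and>
              measure lebesgue U \<le> c * measure lebesgue (ball x d)"
  obtains T' where "S \<subseteq> T'" "T' \<in> lmeasurable" "measure lebesgue T' \<le> c * measure lebesgue T"
proof -
  let ?\<mu> = "measure lebesgue"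
  let ?B = "\<lambda>p::'a \<times> real. ball (fst p) (snd p)"
  define K where "K = {p. ?B p \<subseteq> T \<and>
    (\<exists>U. S \<inter> ball (fst p) (snd p) \<subseteq> U \<and> U \<in> lmeasurable \<and> ?\<mu> U \<le> c * ?\<mu> (?B p))}"
  obtain C where "countable C" and Csub: "C \<subseteq> K"
    and pwC: "pairwise (\<lambda>i j. disjnt (?B i) (?B j)) C"
    and negC: "negligible (S - (\<Union>i \<in> C. ?B i))"
  proof (rule Vitali_covering_theorem_balls [of S K fst snd])
    fix x and e :: real
    assume x: "x \<in> S" and "e > 0"
    obtain k where "k > 0" and k: "ball x k \<subseteq> T"
      using T x by (metis open_contains_ball subsetD)
    obtain d U where d: "0 < d" "d < min e k" "S \<inter> ball x d \<subseteq> U" "U \<in> lmeasurable"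
        "?\<mu> U \<le> c * ?\<mu> (ball x d)"
      using dens[OF x, of "min e k"] \<open>e > 0\<close> \<open>k > 0\<close> unfolding min_less_iff_conj by blast
    moreover have "ball x d \<subseteq> T"
      using subset_ball[of d k x] d(2) k by auto
    ultimately show "\<exists>i. i \<in> K \<and> x \<in> ?B i \<and> snd i < e"
      using x unfolding K_def by (intro exI[of _ "(x,d)"] conjI CollectI exI[of _ U]) simp_all
  qed
  have CT: "?B p \<subseteq> T" if "p \<in> C" for p
    using that Csub by (auto simp: K_def)
  have "\<forall>p\<in>C. \<exists>U. S \<inter> ?B p \<subseteq> U \<and> U \<in> lmeasurable \<and> ?\<mu> U \<le> c * ?\<mu> (?B p)"
    using Csub unfolding K_def by blast
  then obtain U where U: "\<And>p. p \<in> C \<Longrightarrow> S \<inter> ?B p \<subseteq> U p"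
    "\<And>p. p \<in> C \<Longrightarrow> U p \<in> lmeasurable"
    "\<And>p. p \<in> C \<Longrightarrow> ?\<mu> (U p) \<le> c * ?\<mu> (?B p)"
    unfolding bchoice_iff by blast
  \<comment> \<open>For the countable union, bounds on finite subfamilies suffice. In each of them,
    disjointness turns the sum of the ball measures into the measure of a union contained in
    \<open>T\<close>.\<close>
  have lee: "?\<mu> (\<Union>i\<in>I. U i) \<le> c * ?\<mu> T" if I: "I \<subseteq> C" "finite I" for I
  proof -
    have "?\<mu> (\<Union>i\<in>I. U i) \<le> (\<Sum>i\<in>I. ?\<mu> (U i))"
      using I U(2) by (intro measure_UNION_le) (auto intro: fmeasurableD)
    also have "\<dots> \<le> (\<Sum>i\<in>I. c * ?\<mu> (?B i))"
      using I U by (intro sum_mono) blast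
    also have "\<dots> = c * (\<Sum>i\<in>I. ?\<mu> (?B i))"
      by (simp add: sum_distrib_left)
    also have "(\<Sum>i\<in>I. ?\<mu> (?B i)) = ?\<mu> (\<Union>i\<in>I. ?B i)"
      using I pwC by (intro measure_UNION'[symmetric]) (auto intro: pairwise_subset)
    also have "c * ?\<mu> (\<Union>i\<in>I. ?B i) \<le> c * ?\<mu> T"
      using I CT T(2) \<open>0 < c\<close> by (intro mult_left_mono measure_le_fmeasurable UN_least) auto
    finally show ?thesis .
  qed
  have UC: "\<Union>(U ` C) \<in> lmeasurable"
    using U(2) lee by (rule fmeasurable_UN_bound [OF \<open>countable C\<close>])
  have UC': "?\<mu> (\<Union>(U ` C)) \<le> c * ?\<mu> T"
    using U(2) lee by (rule measure_UN_bound [OF \<open>countable C\<close>])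
  let ?N = "S - (\<Union>i \<in> C. ?B i)"
  show thesis
  proof
    show "S \<subseteq> ?N \<union> \<Union>(U ` C)"
      using U(1) by blast
    show "?N \<union> \<Union>(U ` C) \<in> lmeasurable"
      using UC negC by (simp add: fmeasurable.Un negligible_imp_measurable)
    have "?\<mu> (?N \<union> \<Union>(U ` C)) \<le> ?\<mu> ?N + ?\<mu> (\<Union>(U ` C))"
      using UC negC by (intro measure_Un_le) (auto intro: fmeasurableD negligible_imp_measurable)
    then show "?\<mu> (?N \<union> \<Union>(U ` C)) \<le> c * ?\<mu> T"
      using UC' negC by (simp add: negligible_imp_measure0)
  qed
qed

lemma lmeasurable_outer_open:
  fixes e :: real
  assumes "S \<in> lmeasurable" "e > 0"
  obtains T where "open T" "S \<subseteq> T" "T \<in> lmeasurable" "measure lebesgue T < measure lebesgue S + e"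
proof -
  obtain T where T: "open T" "S \<subseteq> T" "(T - S) \<in> lmeasurable" "emeasure lebesgue (T - S) < ennreal e"
    using sets_lebesgue_outer_open assms fmeasurableD by metis
  have eq: "T = S \<union> (T - S)" using T by auto
  have "T \<in> lmeasurable" using eq T assms by (metis fmeasurable.Un)
  moreover have "measure lebesgue (T - S) < e"
    using T assms by (simp add: emeasure_eq_measure2 ennreal_less_iff)
  moreover have "measure lebesgue T \<le> measure lebesgue S + measure lebesgue (T - S)"
    using measure_Un_le[of S lebesgue "T - S"] eq T assms by (metis fmeasurableD)
  ultimately show thesis using that T by force
qed

text \<open>The outer measure of a bounded piece of \<open>S\<close> is finite and, by
  \<open>outer_measure_shrinks\<close>, at most a factor below 1 times itself, so it vanishes.
  Countably many such pieces exhaust \<open>S\<close>.\<close>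

lemma negligible_density_less_one:
  fixes S :: "'a::euclidean_space set"
  assumes "c < 1"
    and dens: "\<And>x e. x \<in> S \<Longrightarrow> e > 0 \<Longrightarrow> \<exists>d U. 0 < d \<and> d < e \<and> S \<inter> ball x d \<subseteq> U \<and> U \<in> lmeasurable \<and>
              measure lebesgue U \<le> c * measure lebesgue (ball x d)"
  shows "negligible S"
proof -
  \<comment> \<open>Both the shrinking lemma and the division in \<open>Inf V / c'\<close> need a
    positive factor. The given \<open>c\<close> may be 0, as it is for the first of the sets in
    \<open>Lebesgue_density\<close>.\<close>
  define c' where "c' = max c (1/2)"
  have c': "0 < c'" "c' < 1" "c \<le> c'" using \<open>c < 1\<close> by (auto simp: c'_def)
  have "negligible (S \<inter> ball 0 (real n))" for n
  proof -
    let ?S = "S \<inter> ball 0 (real n)"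
    \<comment> \<open>\<open>Inf V\<close> is the outer Lebesgue measure of the bounded
      piece.\<close>
    define V where "V = {measure lebesgue T |T. open T \<and> ?S \<subseteq> T \<and> T \<in> lmeasurable}"
    have "measure lebesgue (ball (0::'a) (real n)) \<in> V"
      unfolding V_def by (intro CollectI exI[of _ "ball 0 (real n)"]) auto
    then have "V \<noteq> {}" by blast
    have bdd: "bdd_below V" by (intro bdd_belowI[of _ 0]) (auto simp: V_def)
    have dens': "\<exists>d U. 0 < d \<and> d < e \<and> ?S \<inter> ball x d \<subseteq> U \<and> U \<in> lmeasurable \<and>
              measure lebesgue U \<le> c' * measure lebesgue (ball x d)" if x: "x \<in> ?S" "e > 0" for x e
    proof -
      obtain d U where d: "0 < d" "d < e" "S \<inter> ball x d \<subseteq> U" "U \<in> lmeasurable"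
              "measure lebesgue U \<le> c * measure lebesgue (ball x d)" using dens[of x e] x by auto
      have "c * measure lebesgue (ball x d) \<le> c' * measure lebesgue (ball x d)"
        using c' by (intro mult_right_mono) auto
      from order_trans[OF d(5) this] show ?thesis
        using d(1-4) by (intro exI[of _ d] exI[of _ U]) blast
    qed
    have "Inf V / c' \<le> t" if t: "t \<in> V" for t
    proof -
      obtain T where T: "open T" "?S \<subseteq> T" "T \<in> lmeasurable" "t = measure lebesgue T"
        using t by (auto simp: V_def)
      obtain T' where T': "?S \<subseteq> T'" "T' \<in> lmeasurable" "measure lebesgue T' \<le> c' * t"
        unfolding T(4) by (rule outer_measure_shrinks[OF T(1,3,2) c'(1) dens'])
      \<comment> \<open>\<open>T'\<close> is only known to be measurable, so it is enlarged to an
        open set, which adds less than \<open>e\<close>.\<close>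
      have "Inf V \<le> c' * t + e" if "e > 0" for e
      proof -
        obtain W where "open W" "T' \<subseteq> W" "W \<in> lmeasurable"
            "measure lebesgue W < measure lebesgue T' + e"
          using T'(2) \<open>e > 0\<close> by (rule lmeasurable_outer_open)
        moreover have "Inf V \<le> measure lebesgue W"
          using calculation T'(1) unfolding V_def[symmetric]
          by (intro cInf_lower[OF _ bdd]) (unfold V_def, blast)
        ultimately show ?thesis using T' by linarith
      qed
      then have "Inf V \<le> c' * t" by (rule field_le_epsilon)
      then show ?thesis using c' by (simp add: field_simps)
    qed
    then have "Inf V / c' \<le> Inf V" using \<open>V \<noteq> {}\<close> by (intro cInf_greatest)
    then have "Inf V * (1 - c') \<le> 0" using c' by (simp add: field_simps)
    then have "Inf V \<le> 0" using c' by (simp add: mult_le_0_iff)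
    show "negligible ?S"
      unfolding negligible_outer
    proof (intro allI impI)
      fix e :: real assume "e > 0"
      then obtain t where "t \<in> V" "t < e"
        using cInf_lessD[OF \<open>V \<noteq> {}\<close>, of e] \<open>Inf V \<le> 0\<close> by auto
      then show "\<exists>T. ?S \<subseteq> T \<and> T \<in> lmeasurable \<and> measure lebesgue T < e"
        by (auto simp: V_def)
    qed
  qed
  then have "negligible (\<Union>n. S \<inter> ball 0 (real n))"
    by (rule negligible_Union_nat)
  moreover have "(\<Union>n. S \<inter> ball 0 (real n)) = S"
    by (auto intro: reals_Archimedean2)
  ultimately show ?thesis by simp
qed

text \<open>The ratio never exceeds 1, so where it does not tend to 1 it drops to some
  \<open>1 - 1 / real (Suc n)\<close> or below at arbitrarily small radii. On each such set
  \<open>S n\<close>, the cover required by \<open>negligible_density_less_one\<close> is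
  \<open>A \<inter> ball x d\<close>.\<close>

lemma Lebesgue_density:
  fixes A :: "'a::euclidean_space set"
  assumes A: "A \<in> sets lebesgue"
  shows "negligible {x \<in> A. \<not> ((\<lambda>d. measure lebesgue (A \<inter> ball x d) / measure lebesgue (ball x d))
                                  \<longlongrightarrow> 1) (at_right 0)}"
proof -
  define r where "r x d = measure lebesgue (A \<inter> ball x d) / measure lebesgue (ball x d)" for x d
  define S where "S n = {x \<in> A. \<not> (\<forall>\<^sub>F d in at_right 0. 1 - 1 / real (Suc n) < r x d)}" for n
  have r1: "r x d \<le> 1" for x d
    unfolding r_def by (intro divide_le_eq_1[THEN iffD2])
      (use measure_le_fmeasurable[of "A \<inter> ball x d" "ball x d" lebesgue] in
        \<open>auto simp: less_le intro: lmeasurable_ball\<close>)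
  have "negligible (S n)" for n
  proof (rule negligible_density_less_one[of "1 - 1 / real (Suc n)"])
    fix x and e :: real assume x: "x \<in> S n" and "e > 0"
    then obtain d where d: "0 < d" "d < e" "r x d \<le> 1 - 1 / real (Suc n)"
      unfolding S_def eventually_at_right_field by (force simp: not_less)
    then have "measure lebesgue (A \<inter> ball x d) \<le> (1 - 1 / real (Suc n)) * measure lebesgue (ball x d)"
      using content_ball_pos[OF d(1), of x] by (simp add: r_def pos_divide_le_eq)
    then show "\<exists>d U. 0 < d \<and> d < e \<and> S n \<inter> ball x d \<subseteq> U \<and> U \<in> lmeasurable \<and>
        measure lebesgue U \<le> (1 - 1 / real (Suc n)) * measure lebesgue (ball x d)"
      using d A by (intro exI[of _ d] exI[of _ "A \<inter> ball x d"]) (auto simp: S_def Int_ball_lmeasurable)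
  qed auto
  then have "negligible (\<Union>n. S n)"
    by (rule negligible_Union_nat)
  moreover have "{x \<in> A. \<not> (r x \<longlongrightarrow> 1) (at_right 0)} \<subseteq> (\<Union>n. S n)"
  proof
    fix x assume x: "x \<in> {x \<in> A. \<not> (r x \<longlongrightarrow> 1) (at_right 0)}"
    show "x \<in> (\<Union>n. S n)"
    proof (rule ccontr)
      assume "x \<notin> (\<Union>n. S n)"
      then have ev: "\<forall>\<^sub>F d in at_right 0. 1 - 1 / real (Suc n) < r x d" for n
        using x by (auto simp: S_def)
      have "(r x \<longlongrightarrow> 1) (at_right 0)"
      proof (rule order_tendstoI)
        fix a :: real assume "a < 1"
        then obtain n where "1 / real (Suc n) < 1 - a"
          using reals_Archimedean[of "1 - a"] by (auto simp: inverse_eq_divide)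
        then show "\<forall>\<^sub>F d in at_right 0. a < r x d"
          using ev[of n] by (auto elim: eventually_mono)
      next
        fix a :: real assume "1 < a"
        then show "\<forall>\<^sub>F d in at_right 0. r x d < a"
          using le_less_trans[OF r1] by (intro always_eventually allI)
      qed
      then show False using x by auto
    qed
  qed
  ultimately show ?thesis unfolding r_def by (rule negligible_subset)
qed

section \<open>Simultaneous limits by Tychonoff's theorem\<close>

lemma cluster_filter_unit_cube:
  fixes \<Phi> :: "'b \<Rightarrow> 'i \<Rightarrow> real"
  assumes "F \<noteq> bot" "\<And>d i. \<Phi> d i \<in> {0..1}"
  obtains H \<mu> where "H \<le> F" "H \<noteq> bot" "\<And>i. \<mu> i \<in> {0..1}" "\<And>i. ((\<lambda>d. \<Phi> d i) \<longlongrightarrow> \<mu> i) H"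
proof -
  \<comment> \<open>The index type is arbitrary (it will consist of all subsets of the space), so
    filters take the place of subsequences: Tychonoff's theorem makes the cube compact, and a proper
    filter on it has a cluster point.\<close>
  let ?K = "PiE UNIV (\<lambda>_::'i. {0..1::real})"
  have "compact ?K"
    unfolding compactin_euclidean_iff[symmetric] euclidean_product_topology[symmetric]
    by (simp add: compactin_PiE)
  moreover have "filtermap \<Phi> F \<noteq> bot" "\<forall>\<^sub>F \<phi> in filtermap \<Phi> F. \<phi> \<in> ?K"
    using assms by (simp_all add: filtermap_bot_iff eventually_filtermap PiE_iff)
  ultimately obtain \<mu> where \<mu>: "\<mu> \<in> ?K" "inf (nhds \<mu>) (filtermap \<Phi> F) \<noteq> bot"
    unfolding compact_filter by blast
  \<comment> \<open>\<open>H\<close> refines \<open>F\<close> by the preimages of the neighbourhoods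
    of \<open>\<mu>\<close>. These meet every set belonging to \<open>F\<close> because
    \<open>\<mu>\<close> is a cluster point, so \<open>H\<close> is proper.\<close>
  define H where "H = inf F (filtercomap \<Phi> (nhds \<mu>))"
  have "H \<noteq> bot"
  proof
    assume "H = bot"
    then have "eventually (\<lambda>_. False) H" by simp
    then obtain P Q where P: "eventually P F" and Q: "eventually Q (nhds \<mu>)"
      and PQ: "\<And>d. P d \<Longrightarrow> Q (\<Phi> d) \<Longrightarrow> False"
      unfolding H_def eventually_inf eventually_filtercomap by blast
    have "eventually (\<lambda>\<phi>. \<exists>d. P d \<and> \<phi> = \<Phi> d) (filtermap \<Phi> F)"
      using P by (auto simp: eventually_filtermap elim: eventually_mono)
    with Q have "eventually (\<lambda>_. False) (inf (nhds \<mu>) (filtermap \<Phi> F))"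
      unfolding eventually_inf using PQ by blast
    with \<mu> show False by (simp add: eventually_False)
  qed
  have lim: "filterlim \<Phi> (nhds \<mu>) H"
    unfolding H_def by (rule filterlim_mono[OF filterlim_filtercomap]) auto
  have "((\<lambda>d. \<Phi> d i) \<longlongrightarrow> \<mu> i) H" for i
  proof (rule topological_tendstoI)
    fix U assume U: "open U" "\<mu> i \<in> U"
    \<comment> \<open>Continuity of the coordinate projection, obtained from
      \<open>product_topology_basis'\<close> with a one-element index set.\<close>
    have "open {\<phi>. \<phi> i \<in> U}"
      using product_topology_basis'[of "{()}" "\<lambda>_. U" "\<lambda>_. i"] U by simp
    then have "eventually (\<lambda>\<phi>. \<phi> i \<in> U) (nhds \<mu>)"
      using U unfolding eventually_nhds by blast
    then show "\<forall>\<^sub>F d in H. \<Phi> d i \<in> U"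
      using lim unfolding filterlim_iff by blast
  qed
  with that \<open>H \<noteq> bot\<close> \<mu>(1) show thesis
    by (metis H_def PiE_mem UNIV_I inf_le1)
qed

section \<open>Relative densities within \<Omega> and approximation by step functions\<close>

lemma borel_subsets_iff:
  "\<Omega> \<in> sets borel \<Longrightarrow> A \<in> borel_subsets \<Omega> \<longleftrightarrow> A \<in> sets borel \<and> A \<subseteq> \<Omega>"
  by (auto simp: sets_restrict_space_iff)

lemma borel_subsets_lebesgue:
  "\<Omega> \<in> sets borel \<Longrightarrow> A \<in> borel_subsets \<Omega> \<Longrightarrow> A \<in> sets lebesgue"
  by (simp add: borel_subsets_iff)

text \<open>\<open>rel_density\<close> is the quotient of the ordinary densities of \<open>A\<close>
  and \<open>\<Omega>\<close>. Almost everywhere in \<open>\<Omega>\<close> the denominator tends to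
  1, while the numerator tends to 1 at points of \<open>A\<close> and to 0 at points of
  \<open>\<Omega> - A\<close>.\<close>

lemma negligible_not_rel_density_convergent:
  fixes \<Omega> :: "'a::euclidean_space set"
  assumes \<Omega>: "\<Omega> \<in> sets borel" and A: "A \<in> borel_subsets \<Omega>"
  shows "negligible {x \<in> \<Omega>. \<not> (\<exists>l. (rel_density \<Omega> x A \<longlongrightarrow> l) (at_right 0))}"
proof -
  define q where "q B x d = measure lebesgue (B \<inter> ball x d) / measure lebesgue (ball x d)"
    for B :: "'a set" and x d
  define D where "D B = {x \<in> B. \<not> (q B x \<longlongrightarrow> 1) (at_right 0)}" for B
  have A': "A \<in> sets lebesgue" "A \<subseteq> \<Omega>" "\<Omega> \<in> sets lebesgue"
    using \<Omega> A by (auto simp: borel_subsets_iff)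
  have D: "negligible (D B)" if "B \<in> sets lebesgue" for B
    using Lebesgue_density[OF that] unfolding D_def q_def .
  have neg: "negligible (D \<Omega> \<union> D A \<union> D (\<Omega> - A))"
    using A' by (intro negligible_Un D) auto
  show ?thesis
  proof (rule negligible_subset[OF neg], intro subsetI, rule ccontr)
    fix x assume x: "x \<in> {x \<in> \<Omega>. \<not> (\<exists>l. (rel_density \<Omega> x A \<longlongrightarrow> l) (at_right 0))}"
      and xD: "x \<notin> D \<Omega> \<union> D A \<union> D (\<Omega> - A)"
    have q\<Omega>: "(q \<Omega> x \<longlongrightarrow> 1) (at_right 0)" using x xD by (auto simp: D_def)
    have eq: "rel_density \<Omega> x A d = q A x d / q \<Omega> x d" if "d > 0" for d
      using that content_ball_pos[OF that, of x] A'(2)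
      by (simp add: rel_density_def q_def Int_absorb2)
    have evq: "\<forall>\<^sub>F d in at_right 0. q A x d / q \<Omega> x d = rel_density \<Omega> x A d"
      using eventually_at_right_less[of 0] by (rule eventually_mono) (simp add: eq)
    have "\<exists>l. (q A x \<longlongrightarrow> l) (at_right 0)"
    proof (cases "x \<in> A")
      case True
      then show ?thesis using xD by (auto simp: D_def)
    next
      case False
      \<comment> \<open>\<open>Lebesgue_density\<close> speaks of points of the set itself; outside
        \<open>A\<close>, the density of \<open>A\<close> comes from that of its complement in
        \<open>\<Omega>\<close>.\<close>
      then have "(q (\<Omega> - A) x \<longlongrightarrow> 1) (at_right 0)" using x xD by (auto simp: D_def)
      with q\<Omega> have "((\<lambda>d. q \<Omega> x d - q (\<Omega> - A) x d) \<longlongrightarrow> 1 - 1) (at_right 0)"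
        by (rule tendsto_diff)
      moreover have "q A x = (\<lambda>d. q \<Omega> x d - q (\<Omega> - A) x d)"
      proof
        fix d
        have "measure lebesgue ((\<Omega> \<inter> ball x d) - (A \<inter> ball x d)) =
            measure lebesgue (\<Omega> \<inter> ball x d) - measure lebesgue (A \<inter> ball x d)"
          using A' by (intro measurable_measure_Diff Int_ball_lmeasurable fmeasurableD[OF Int_ball_lmeasurable]) auto
        moreover have "(\<Omega> \<inter> ball x d) - (A \<inter> ball x d) = (\<Omega> - A) \<inter> ball x d" by auto
        ultimately show "q A x d = q \<Omega> x d - q (\<Omega> - A) x d"
          by (simp add: q_def diff_divide_distrib)
      qed
      ultimately have "(q A x \<longlongrightarrow> 1 - 1) (at_right 0)" by (simp only:)
      then show ?thesis by blast
    qed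
    then obtain l where "(q A x \<longlongrightarrow> l) (at_right 0)" by blast
    then have "((\<lambda>d. q A x d / q \<Omega> x d) \<longlongrightarrow> l / 1) (at_right 0)"
      using q\<Omega> by (rule tendsto_divide) simp
    then have "(rel_density \<Omega> x A \<longlongrightarrow> l / 1) (at_right 0)"
      using evq by (rule Lim_transform_eventually)
    then show False using x by blast
  qed
qed

text \<open>A Borel function that agrees with \<open>g\<close> almost everywhere is truncated at the
  essential bound and rounded down to multiples of \<open>1 / real (Suc k)\<close>. The change of
  representative yields Borel step functions, as \<open>has_ba_integral\<close> demands, from a
  Lebesgue measurable \<open>g\<close>.\<close>

lemma Linf_simple_approx:
  fixes \<Omega> :: "'a::euclidean_space set"
  assumes \<Omega>: "\<Omega> \<in> sets borel" and g: "g \<in> Linf \<Omega>"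
  obtains s :: "nat \<Rightarrow> 'a \<Rightarrow> real"
  where "\<And>k. simple_function (restrict_space borel \<Omega>) (s k)"
    "\<And>k. AE x in lebesgue_on \<Omega>. \<bar>s k x - g x\<bar> \<le> 1 / real (Suc k)"
proof -
  obtain C0 where C0: "AE x in lebesgue_on \<Omega>. \<bar>g x\<bar> \<le> C0"
    using g by (auto simp: Linf_def)
  define C where "C = \<bar>C0\<bar>"
  have "C \<ge> 0" and C: "AE x in lebesgue_on \<Omega>. \<bar>g x\<bar> \<le> C"
    using C0 by (auto simp: C_def elim: eventually_mono)
  have "g \<in> borel_measurable (lebesgue_on \<Omega>)" using g by (simp add: Linf_def)
  then have "(\<lambda>x. indicator \<Omega> x *\<^sub>R g x) \<in> borel_measurable lebesgue"
    using \<Omega> by (subst (asm) borel_measurable_restrict_space_iff) auto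
  then obtain g' where g': "g' \<in> borel_measurable lborel"
      "AE x in lborel. indicator \<Omega> x *\<^sub>R g x = g' x"
    using completion_ex_borel_measurable_real by blast
  have "AE x in lebesgue. indicator \<Omega> x *\<^sub>R g x = g' x"
    using g'(2) by (rule AE_completion)
  then have gg': "AE x in lebesgue_on \<Omega>. g x = g' x"
    using \<Omega> by (subst AE_restrict_space_iff) (auto elim!: eventually_mono)
  \<comment> \<open>Truncation makes the bound hold everywhere, so that rounding leaves only
    finitely many values.\<close>
  define h where "h x = max (- C) (min C (g' x))" for x
  have h: "- C \<le> h x" "h x \<le> C" for x using \<open>C \<ge> 0\<close> by (auto simp: h_def)
  have hm: "h \<in> borel_measurable borel" using g'(1) unfolding h_def by simp
  define s where "s k x = of_int \<lfloor>h x * real (Suc k)\<rfloor> / real (Suc k)" for k x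
  show thesis
  proof
    fix k
    have "s k ` space (restrict_space borel \<Omega>) \<subseteq>
        (\<lambda>i. of_int i / real (Suc k)) ` {\<lfloor>- C * real (Suc k)\<rfloor>..\<lfloor>C * real (Suc k)\<rfloor>}"
    proof (intro image_subsetI)
      fix x
      have "- C * real (Suc k) \<le> h x * real (Suc k)" "h x * real (Suc k) \<le> C * real (Suc k)"
        by (intro mult_right_mono h of_nat_0_le_iff)+
      then show "s k x \<in> (\<lambda>i. of_int i / real (Suc k)) ` {\<lfloor>- C * real (Suc k)\<rfloor>..\<lfloor>C * real (Suc k)\<rfloor>}"
        unfolding s_def by (intro imageI) (simp only: atLeastAtMost_iff floor_mono simp_thms)
    qed
    then have "finite (s k ` space (restrict_space borel \<Omega>))"
      by (rule finite_subset) simp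
    moreover have "s k \<in> borel_measurable (restrict_space borel \<Omega>)"
    proof -
      have "(\<lambda>x. of_int \<lfloor>h x * c\<rfloor> / c) \<in> borel_measurable borel" for c :: real
        using hm by measurable
      then show ?thesis unfolding s_def by (rule measurable_restrict_space1)
    qed
    ultimately show "simple_function (restrict_space borel \<Omega>) (s k)"
      by (intro simple_function_borel_measurable)
    show "AE x in lebesgue_on \<Omega>. \<bar>s k x - g x\<bar> \<le> 1 / real (Suc k)"
      using C gg'
    proof eventually_elim
      fix x assume "\<bar>g x\<bar> \<le> C" "g x = g' x"
      then have "h x = g x" by (auto simp: h_def)
      moreover have "\<bar>s k x - h x\<bar> = \<bar>of_int \<lfloor>h x * real (Suc k)\<rfloor> - h x * real (Suc k)\<bar> / real (Suc k)"
        by (simp add: s_def field_simps del: of_nat_Suc)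
      moreover have "\<bar>of_int \<lfloor>h x * real (Suc k)\<rfloor> - h x * real (Suc k)\<bar> \<le> 1"
        by linarith
      ultimately show "\<bar>s k x - g x\<bar> \<le> 1 / real (Suc k)"
        by (simp add: divide_right_mono)
    qed
  qed
qed

lemma simple_function_Linf:
  assumes \<Omega>: "\<Omega> \<in> sets borel" and s: "simple_function (restrict_space borel \<Omega>) s"
  shows "s \<in> Linf \<Omega>"
proof -
  have fin: "finite (s ` \<Omega>)" using simple_functionD(1)[OF s] \<Omega> by (simp add: space_restrict_space)
  have "s \<in> borel_measurable (restrict_space borel \<Omega>)"
    using s by (rule borel_measurable_simple_function)
  then have "(\<lambda>x. indicator \<Omega> x *\<^sub>R s x) \<in> borel_measurable borel"
    using \<Omega> by (subst (asm) borel_measurable_restrict_space_iff) auto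
  then have "(\<lambda>x. indicator \<Omega> x *\<^sub>R s x) \<in> borel_measurable lebesgue"
    by (intro measurable_completion) simp
  then have "s \<in> borel_measurable (lebesgue_on \<Omega>)"
    using \<Omega> by (subst borel_measurable_restrict_space_iff) auto
  moreover have "AE x in lebesgue_on \<Omega>. \<bar>s x\<bar> \<le> Max (abs ` s ` \<Omega>)"
    using fin by (intro AE_I2) (auto intro!: Max_ge)
  ultimately show ?thesis by (auto simp: Linf_def)
qed

section \<open>Averages over balls and their limits\<close>

lemma Omega_hat_measure_pos:
  assumes "\<Omega> \<in> sets borel" "x \<in> Omega_hat \<Omega>" "\<delta> > 0"
  shows "measure lebesgue (\<Omega> \<inter> ball x \<delta>) > 0"
proof -
  have "\<Omega> \<inter> ball x \<delta> \<in> lmeasurable" using assms by (intro Int_ball_lmeasurable) auto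
  moreover have "emeasure lebesgue (\<Omega> \<inter> ball x \<delta>) > 0"
    using assms unfolding Omega_hat_def by blast
  ultimately show ?thesis by (metis emeasure_eq_measure2 ennreal_less_zero_iff)
qed

text \<open>Averaging does not increase the essential supremum. The bound is the same for all radii,
  and this uniformity later carries limits in \<open>\<delta>\<close> from step functions to
  \<open>g\<close>.\<close>

lemma ball_avg_dist_le:
  fixes \<Omega> :: "'a::euclidean_space set"
  assumes \<Omega>: "\<Omega> \<in> sets borel" and x: "x \<in> Omega_hat \<Omega>" and "\<delta> > 0"
    and g: "g \<in> Linf \<Omega>" and h: "h \<in> Linf \<Omega>"
    and close: "AE x in lebesgue_on \<Omega>. \<bar>g x - h x\<bar> \<le> e"
  shows "\<bar>ball_avg \<Omega> g x \<delta> - ball_avg \<Omega> h x \<delta>\<bar> \<le> e"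
proof -
  let ?B = "ball x \<delta> \<inter> \<Omega>"
  have B: "?B \<in> lmeasurable" using \<Omega> by (intro ball_Int_lmeasurable) auto
  then interpret finite_measure "lebesgue_on ?B" by (rule finite_measure_lebesgue_on)
  have AE_B: "AE y in lebesgue_on ?B. P y" if "AE y in lebesgue_on \<Omega>. P y" for P
    using that \<Omega> B by (auto simp: AE_restrict_space_iff fmeasurableD elim: eventually_mono)
  have int: "integrable (lebesgue_on ?B) u" if u: "u \<in> Linf \<Omega>" for u
  proof -
    have um: "u \<in> borel_measurable (lebesgue_on \<Omega>)" and
      "\<exists>C. AE y in lebesgue_on \<Omega>. \<bar>u y\<bar> \<le> C" using u by (auto simp: Linf_def)
    then obtain C where "AE y in lebesgue_on \<Omega>. \<bar>u y\<bar> \<le> C" by blast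
    then have "AE y in lebesgue_on ?B. norm (u y) \<le> C" using AE_B by simp
    moreover have "u \<in> borel_measurable (lebesgue_on ?B)"
      using um by (rule measurable_restrict_mono) auto
    ultimately show ?thesis by (rule integrable_const_bound)
  qed
  have m: "measure lebesgue ?B > 0"
    using Omega_hat_measure_pos[OF \<Omega> x \<open>\<delta> > 0\<close>] by (simp add: Int_commute)
  have "\<bar>(LINT y|lebesgue_on ?B. g y) - (LINT y|lebesgue_on ?B. h y)\<bar> =
      norm (LINT y|lebesgue_on ?B. g y - h y)"
    using int[OF g] int[OF h] by simp
  also have "\<dots> \<le> (LINT y|lebesgue_on ?B. norm (g y - h y))"
    by (rule integral_norm_bound)
  also have "\<dots> \<le> (LINT y|lebesgue_on ?B. e)"
    using int[OF g] int[OF h] AE_B[OF close] by (intro integral_mono_AE) auto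
  also have "\<dots> = e * measure lebesgue ?B"
    using B by (simp add: measure_restrict_space fmeasurableD)
  finally show ?thesis
    using m by (simp add: ball_avg_def flip: diff_divide_distrib) (simp add: field_simps)
qed

text \<open>The right-hand side is \<open>ba_step_integral\<close> for the set function that sends
  \<open>A\<close> to \<open>rel_density \<Omega> x A \<delta>\<close>. Limits of relative densities
  thus become limits of averages of step functions.\<close>

lemma ball_avg_simple:
  fixes \<Omega> :: "'a::euclidean_space set"
  assumes \<Omega>: "\<Omega> \<in> sets borel" and s: "simple_function (restrict_space borel \<Omega>) s"
  shows "ball_avg \<Omega> s x \<delta> = (\<Sum>y\<in>s ` \<Omega>. y * rel_density \<Omega> x (s -` {y} \<inter> \<Omega>) \<delta>)"
proof -
  let ?B = "ball x \<delta> \<inter> \<Omega>"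
  have B: "?B \<in> lmeasurable" using \<Omega> by (intro ball_Int_lmeasurable) auto
  then interpret finite_measure "lebesgue_on ?B" by (rule finite_measure_lebesgue_on)
  have fin: "finite (s ` \<Omega>)" using simple_functionD(1)[OF s] \<Omega> by (simp add: space_restrict_space)
  have S: "s -` {y} \<inter> \<Omega> \<in> sets lebesgue" for y
    using simple_functionD(2)[OF s, of "{y}"] \<Omega>
    by (intro borel_subsets_lebesgue[OF \<Omega>]) (simp add: space_restrict_space)
  have SB: "s -` {y} \<inter> \<Omega> \<inter> ball x \<delta> \<in> sets (lebesgue_on ?B)" for y
    using S[of y] B by (auto simp: sets_restrict_space_iff fmeasurableD intro!: sets.Int)
  have "(LINT z|lebesgue_on ?B. s z) =
      (LINT z|lebesgue_on ?B. (\<Sum>y\<in>s ` \<Omega>. y * indicator (s -` {y} \<inter> \<Omega> \<inter> ball x \<delta>) z))"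
  proof (rule Bochner_Integration.integral_cong[OF refl])
    fix z assume "z \<in> space (lebesgue_on ?B)"
    then have z: "z \<in> \<Omega>" "z \<in> ball x \<delta>" by auto
    then have "(\<Sum>y\<in>s ` \<Omega>. y * indicator (s -` {y} \<inter> \<Omega> \<inter> ball x \<delta>) z) =
        (\<Sum>y\<in>s ` \<Omega>. if y = s z then y else 0)"
      by (intro sum.cong) (auto simp: indicator_def)
    also have "\<dots> = s z" using fin z by simp
    finally show "s z = (\<Sum>y\<in>s ` \<Omega>. y * indicator (s -` {y} \<inter> \<Omega> \<inter> ball x \<delta>) z)" ..
  qed
  also have "\<dots> = (\<Sum>y\<in>s ` \<Omega>. y * measure lebesgue (s -` {y} \<inter> \<Omega> \<inter> ball x \<delta>))"
  proof (subst Bochner_Integration.integral_sum)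
    show "integrable (lebesgue_on ?B) (\<lambda>z. y * indicator (s -` {y} \<inter> \<Omega> \<inter> ball x \<delta>) z)" for y
      using SB[of y] by (intro integrable_mult_right integrable_real_indicator) (auto simp: emeasure_finite less_top[symmetric])
    have "measure (lebesgue_on ?B) (s -` {y} \<inter> \<Omega> \<inter> ball x \<delta>) =
        measure lebesgue (s -` {y} \<inter> \<Omega> \<inter> ball x \<delta>)" for y
      using B by (intro measure_restrict_space) (auto simp: fmeasurableD)
    moreover have "s -` {y} \<inter> \<Omega> \<inter> ball x \<delta> \<inter> ?B = s -` {y} \<inter> \<Omega> \<inter> ball x \<delta>" for y by auto
    ultimately show "(\<Sum>y\<in>s ` \<Omega>. (LINT z|lebesgue_on ?B. y * indicator (s -` {y} \<inter> \<Omega> \<inter> ball x \<delta>) z)) =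
        (\<Sum>y\<in>s ` \<Omega>. y * measure lebesgue (s -` {y} \<inter> \<Omega> \<inter> ball x \<delta>))"
      by simp
  qed
  finally show ?thesis
    by (simp add: ball_avg_def rel_density_def sum_divide_distrib Int_commute Int_assoc)
qed

lemma level_set_borel_subsets:
  assumes "\<Omega> \<in> sets borel" "simple_function (restrict_space borel \<Omega>) s"
  shows "s -` {y} \<inter> \<Omega> \<in> borel_subsets \<Omega>"
  using simple_functionD(2)[OF assms(2), of "{y}"] assms(1) by (simp add: space_restrict_space)

text \<open>For a step function the averages converge wherever the relative densities of its
  finitely many level sets do. Countably many step functions approximating \<open>g\<close> leave a
  negligible exceptional set, and off it the limits carry over to \<open>g\<close>. The restriction
  to \<open>\<Omega>\<close> stems from \<open>negligible_not_rel_density_convergent\<close>, which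
  concerns points of \<open>\<Omega>\<close> only.\<close>

lemma negligible_not_star_exists:
  fixes \<Omega> :: "'a::euclidean_space set"
  assumes \<Omega>: "\<Omega> \<in> sets borel" and g: "g \<in> Linf \<Omega>"
  shows "negligible {x \<in> Omega_hat \<Omega> \<inter> \<Omega>. \<not> star_exists \<Omega> g x}"
proof -
  obtain s :: "nat \<Rightarrow> 'a \<Rightarrow> real" where s: "\<And>k. simple_function (restrict_space borel \<Omega>) (s k)"
    "\<And>k. AE x in lebesgue_on \<Omega>. \<bar>s k x - g x\<bar> \<le> 1 / real (Suc k)"
    using Linf_simple_approx[OF \<Omega> g] by blast
  define N where "N A = {x \<in> \<Omega>. \<not> (\<exists>l. (rel_density \<Omega> x A \<longlongrightarrow> l) (at_right 0))}" for A
  let ?N = "\<Union>k. \<Union>y\<in>s k ` \<Omega>. N (s k -` {y} \<inter> \<Omega>)"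
  have "negligible (\<Union>y\<in>s k ` \<Omega>. N (s k -` {y} \<inter> \<Omega>))" for k
  proof (rule negligible_Union)
    show "finite ((\<lambda>y. N (s k -` {y} \<inter> \<Omega>)) ` (s k ` \<Omega>))"
      using simple_functionD(1)[OF s(1)[of k]] \<Omega> by (simp add: space_restrict_space)
    fix T assume "T \<in> (\<lambda>y. N (s k -` {y} \<inter> \<Omega>)) ` (s k ` \<Omega>)"
    then show "negligible T"
      using negligible_not_rel_density_convergent[OF \<Omega> level_set_borel_subsets[OF \<Omega> s(1)]]
      by (auto simp: N_def)
  qed
  then have negN: "negligible ?N" by (rule negligible_Union_nat)
  have "{x \<in> Omega_hat \<Omega> \<inter> \<Omega>. \<not> star_exists \<Omega> g x} \<subseteq> ?N"
  proof (intro subsetI, rule ccontr)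
    fix x assume x: "x \<in> {x \<in> Omega_hat \<Omega> \<inter> \<Omega>. \<not> star_exists \<Omega> g x}" and "x \<notin> ?N"
    then have "\<exists>l. (rel_density \<Omega> x (s k -` {y} \<inter> \<Omega>) \<longlongrightarrow> l) (at_right 0)" if "y \<in> s k ` \<Omega>" for k y
      using that by (auto simp: N_def)
    note ex = this
    define l where "l k y = (SOME l. (rel_density \<Omega> x (s k -` {y} \<inter> \<Omega>) \<longlongrightarrow> l) (at_right 0))" for k y
    have l: "(rel_density \<Omega> x (s k -` {y} \<inter> \<Omega>) \<longlongrightarrow> l k y) (at_right 0)" if "y \<in> s k ` \<Omega>" for k y
      unfolding l_def by (rule someI_ex[OF ex[OF that]])
    define L where "L k = (\<Sum>y\<in>s k ` \<Omega>. y * l k y)" for k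
    have L: "(ball_avg \<Omega> (s k) x \<longlongrightarrow> L k) (at_right 0)" for k
      unfolding L_def ball_avg_simple[OF \<Omega> s(1), abs_def] by (intro tendsto_intros l)
    have unif: "\<bar>ball_avg \<Omega> (s k) x \<delta> - ball_avg \<Omega> g x \<delta>\<bar> \<le> 1 / real (Suc k)" if "\<delta> > 0" for k \<delta>
      using ball_avg_dist_le[OF \<Omega> _ that simple_function_Linf[OF \<Omega> s(1)] g s(2)] x by blast
    have small: "\<exists>M. \<forall>k\<ge>M. 1 / real (Suc k) < e" if e: "e > 0" for e :: real
    proof -
      obtain M where "1 / real (Suc M) < e"
        using reals_Archimedean[OF e] by (auto simp: inverse_eq_divide)
      moreover have "1 / real (Suc k) \<le> 1 / real (Suc M)" if "k \<ge> M" for k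
        using that by (simp add: field_simps)
      ultimately show ?thesis by (meson le_less_trans)
    qed
    \<comment> \<open>At each radius both averages are close to that of \<open>g\<close>; the
      resulting bound survives as \<open>\<delta>\<close> tends to 0 and makes \<open>L\<close> a
      Cauchy sequence.\<close>
    have LL: "\<bar>L j - L k\<bar> \<le> 1 / real (Suc j) + 1 / real (Suc k)" for j k
    proof (rule tendsto_upperbound)
      show "((\<lambda>\<delta>. \<bar>ball_avg \<Omega> (s j) x \<delta> - ball_avg \<Omega> (s k) x \<delta>\<bar>) \<longlongrightarrow> \<bar>L j - L k\<bar>) (at_right 0)"
        by (intro tendsto_intros L)
      show "\<forall>\<^sub>F \<delta> in at_right 0. \<bar>ball_avg \<Omega> (s j) x \<delta> - ball_avg \<Omega> (s k) x \<delta>\<bar> \<le> 1 / real (Suc j) + 1 / real (Suc k)"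
        using eventually_at_right_less[of 0]
      proof (rule eventually_mono)
        fix \<delta> :: real assume "0 < \<delta>"
        from unif[OF this, of j] unif[OF this, of k]
        show "\<bar>ball_avg \<Omega> (s j) x \<delta> - ball_avg \<Omega> (s k) x \<delta>\<bar> \<le> 1 / real (Suc j) + 1 / real (Suc k)"
          by linarith
      qed
    qed simp
    have "Cauchy L"
    proof (rule metric_CauchyI)
      fix e :: real assume "e > 0"
      then obtain M where M: "\<forall>k\<ge>M. 1 / real (Suc k) < e / 2" using small[of "e/2"] by auto
      have "dist (L m) (L n) < e" if "m \<ge> M" "n \<ge> M" for m n
        using M[rule_format, OF that(1)] M[rule_format, OF that(2)] LL[of m n]
        by (simp add: dist_real_def)
      then show "\<exists>M. \<forall>m\<ge>M. \<forall>n\<ge>M. dist (L m) (L n) < e" by blast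
    qed
    then obtain l' where l': "L \<longlonglongrightarrow> l'" using real_Cauchy_convergent convergent_def by blast
    \<comment> \<open>The approximation is uniform over all positive radii, so the limits in
      \<open>k\<close> and in \<open>\<delta>\<close> may be interchanged.\<close>
    have "uniform_limit {0<..} (\<lambda>k. ball_avg \<Omega> (s k) x) (ball_avg \<Omega> g x) sequentially"
    proof (rule uniform_limitI)
      fix e :: real assume "e > 0"
      then obtain M where "\<forall>k\<ge>M. 1 / real (Suc k) < e" using small by blast
      then show "\<forall>\<^sub>F k in sequentially. \<forall>\<delta>\<in>{0<..}. dist (ball_avg \<Omega> (s k) x \<delta>) (ball_avg \<Omega> g x \<delta>) < e"
        unfolding eventually_sequentially dist_real_def
        by (intro exI[of _ M] allI impI ballI le_less_trans[OF unif]) auto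
    qed
    then have "(ball_avg \<Omega> g x \<longlongrightarrow> l') (at_right 0)"
      using L l' by (intro swap_uniform_limit[where f = "\<lambda>k. ball_avg \<Omega> (s k) x" and g = L]) auto
    then show False using x by (auto simp: star_exists_def)
  qed
  with negN show ?thesis by (rule negligible_subset)
qed


section \<open>Cluster points of the relative densities as elements of \<open>ba\<close>\<close>

lemma rel_density_bounds:
  assumes "\<Omega> \<in> sets borel"
  shows "rel_density \<Omega> x A \<delta> \<in> {0..1}"
proof -
  \<comment> \<open>The compactness argument asks for values in the unit interval for every set
    \<open>A\<close> and every real \<open>\<delta>\<close>. The conventions cover the odd cases: a
    non-measurable set has \<open>measure\<close> 0, and division by 0 gives 0.\<close>
  have "measure lebesgue (A \<inter> \<Omega> \<inter> ball x \<delta>) \<le> measure lebesgue (\<Omega> \<inter> ball x \<delta>)"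
    using assms by (intro measure_le_fmeasurable Int_ball_lmeasurable) auto
  then show ?thesis
    by (auto simp: rel_density_def divide_le_eq_1 less_le)
qed

text \<open>This identity and the vanishing on null sets below persist under limits, so that a
  cluster point inherits both.\<close>

lemma rel_density_Un:
  assumes \<Omega>: "\<Omega> \<in> sets borel" and "A \<in> borel_subsets \<Omega>" "B \<in> borel_subsets \<Omega>" "A \<inter> B = {}"
  shows "rel_density \<Omega> x (A \<union> B) \<delta> = rel_density \<Omega> x A \<delta> + rel_density \<Omega> x B \<delta>"
proof -
  have AB: "A \<inter> \<Omega> \<inter> ball x \<delta> \<in> lmeasurable" "B \<inter> \<Omega> \<inter> ball x \<delta> \<in> lmeasurable"
    using assms by (auto simp: borel_subsets_iff intro!: Int_ball_lmeasurable)
  have "measure lebesgue ((A \<inter> \<Omega> \<inter> ball x \<delta>) \<union> (B \<inter> \<Omega> \<inter> ball x \<delta>)) =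
      measure lebesgue (A \<inter> \<Omega> \<inter> ball x \<delta>) + measure lebesgue (B \<inter> \<Omega> \<inter> ball x \<delta>)"
  proof -
    have "(A \<inter> \<Omega> \<inter> ball x \<delta>) \<inter> (B \<inter> \<Omega> \<inter> ball x \<delta>) = {}"
      using \<open>A \<inter> B = {}\<close> by blast
    then show ?thesis using measure_Un3[OF AB] by simp
  qed
  then show ?thesis
    by (simp add: rel_density_def Int_Un_distrib2 add_divide_distrib)
qed

lemma rel_density_null:
  assumes "\<Omega> \<in> sets borel" "A \<in> borel_subsets \<Omega>" "emeasure lebesgue A = 0"
  shows "rel_density \<Omega> x A \<delta> = 0"
proof -
  have "A \<in> null_sets lebesgue"
    using assms borel_subsets_lebesgue by (intro null_setsI) blast+
  then have "negligible A" by (simp only: negligible_iff_null_sets)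
  then have "negligible (A \<inter> \<Omega> \<inter> ball x \<delta>)" by (rule negligible_subset) auto
  then show ?thesis by (simp add: rel_density_def negligible_imp_measure0)
qed

text \<open>A single filter \<open>H\<close> finer than \<open>at_right 0\<close> makes all relative
  densities converge at once, and their limits form \<open>\<mu>\<close>. Integrals of step
  functions against \<open>\<mu>\<close> are then limits of ball averages along \<open>H\<close>.
  Where the averages of \<open>g\<close> have a limit at 0, they have the same limit along
  \<open>H\<close>, and uniform approximation forces the integral of \<open>g\<close> to equal
  it.\<close>

lemma exists_ba_integral_eq_star:
  fixes \<Omega> :: "'a::euclidean_space set"
  assumes \<Omega>: "\<Omega> \<in> sets borel" and x: "x \<in> Omega_hat \<Omega>"
  obtains \<mu> where "\<mu> \<in> ba \<Omega>"
    "\<And>g. g \<in> Linf \<Omega> \<Longrightarrow> star_exists \<Omega> g x \<Longrightarrow> ba_integral \<Omega> \<mu> g = star \<Omega> g x"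
proof -
  have "(at_right (0::real)) \<noteq> bot" by simp
  then obtain H \<mu> where H: "H \<le> at_right 0" "H \<noteq> bot" and \<mu>01: "\<And>A. \<mu> A \<in> {0..1}"
    and lim: "\<And>A. ((\<lambda>\<delta>. rel_density \<Omega> x A \<delta>) \<longlongrightarrow> \<mu> A) H"
    by (rule cluster_filter_unit_cube[where \<Phi> = "\<lambda>\<delta> A. rel_density \<Omega> x A \<delta>"])
      (use rel_density_bounds[OF \<Omega>] in blast)+
  have pos: "\<forall>\<^sub>F \<delta> in H. 0 < \<delta>"
    using filter_leD[OF H(1) eventually_at_right_less] .
  have "\<mu> \<in> ba \<Omega>"
    unfolding ba_def mem_Collect_eq
  proof (intro conjI ballI impI)
    show "additive (borel_subsets \<Omega>) \<mu>"
      unfolding additive_def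
    proof (intro ballI impI)
      fix A B assume AB: "A \<in> borel_subsets \<Omega>" "B \<in> borel_subsets \<Omega>" "A \<inter> B = {}"
      have "((\<lambda>\<delta>. rel_density \<Omega> x A \<delta> + rel_density \<Omega> x B \<delta>) \<longlongrightarrow> \<mu> A + \<mu> B) H"
        by (intro tendsto_intros lim)
      then have "((\<lambda>\<delta>. rel_density \<Omega> x (A \<union> B) \<delta>) \<longlongrightarrow> \<mu> A + \<mu> B) H"
        by (simp only: rel_density_Un[OF \<Omega> AB])
      then show "\<mu> (A \<union> B) = \<mu> A + \<mu> B" by (rule tendsto_unique[OF H(2) lim])
    qed
    show "bounded (\<mu> ` borel_subsets \<Omega>)"
      using \<mu>01 by (intro bounded_subset[OF bounded_closed_interval[of 0 1]]) blast
    fix A assume "A \<in> borel_subsets \<Omega>" "emeasure lebesgue A = 0"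
    then have "((\<lambda>\<delta>. 0) \<longlongrightarrow> \<mu> A) H"
      using lim[of A] by (simp only: rel_density_null[OF \<Omega>])
    then show "\<mu> A = 0" using tendsto_unique[OF H(2) _ tendsto_const] by blast
  qed
  moreover have "ba_integral \<Omega> \<mu> g = star \<Omega> g x"
    if g: "g \<in> Linf \<Omega>" and ex: "star_exists \<Omega> g x" for g
  proof -
    obtain l where l: "(ball_avg \<Omega> g x \<longlongrightarrow> l) (at_right 0)"
      using ex by (auto simp: star_exists_def)
    have "star \<Omega> g x = l"
      using ex tendsto_Lim[OF _ l] by (simp add: star_def)
    \<comment> \<open>The central estimate: along \<open>H\<close> the averages of \<open>s\<close>
      tend to \<open>ba_step_integral \<Omega> \<mu> s\<close> and those of \<open>g\<close> to
      \<open>l\<close>, while the two differ by at most \<open>e\<close>.\<close>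
    have step: "\<bar>ba_step_integral \<Omega> \<mu> s - l\<bar> \<le> e"
      if s: "simple_function (restrict_space borel \<Omega>) s"
        and e: "AE x in lebesgue_on \<Omega>. \<bar>s x - g x\<bar> \<le> e" for s e
    proof (rule tendsto_upperbound[OF _ _ H(2)])
      have "(ball_avg \<Omega> s x \<longlongrightarrow> ba_step_integral \<Omega> \<mu> s) H"
        unfolding ba_step_integral_def ball_avg_simple[OF \<Omega> s, abs_def]
        by (intro tendsto_intros lim)
      then show "((\<lambda>\<delta>. \<bar>ball_avg \<Omega> s x \<delta> - ball_avg \<Omega> g x \<delta>\<bar>) \<longlongrightarrow> \<bar>ba_step_integral \<Omega> \<mu> s - l\<bar>) H"
        by (intro tendsto_intros tendsto_mono[OF H(1) l])
      show "\<forall>\<^sub>F \<delta> in H. \<bar>ball_avg \<Omega> s x \<delta> - ball_avg \<Omega> g x \<delta>\<bar> \<le> e"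
        using pos by (rule eventually_mono)
          (intro ball_avg_dist_le[OF \<Omega> x _ simple_function_Linf[OF \<Omega> s] g e])
    qed
    \<comment> \<open>Since \<open>ba_integral\<close> is defined by \<open>THE\<close>, the value
      \<open>l\<close> has to be attained by some approximating sequence and to be the only possible
      one; \<open>step\<close> settles both.\<close>
    have "has_ba_integral \<Omega> \<mu> g I \<longleftrightarrow> I = l" for I
    proof
      assume "has_ba_integral \<Omega> \<mu> g I"
      then obtain s :: "nat \<Rightarrow> 'a \<Rightarrow> real" where s: "\<And>k. simple_function (restrict_space borel \<Omega>) (s k)"
        "\<And>e. e > 0 \<Longrightarrow> \<forall>\<^sub>F k in sequentially. AE x in lebesgue_on \<Omega>. \<bar>s k x - g x\<bar> \<le> e"
        "(\<lambda>k. ba_step_integral \<Omega> \<mu> (s k)) \<longlonglongrightarrow> I"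
        unfolding has_ba_integral_def by blast
      have "(\<lambda>k. ba_step_integral \<Omega> \<mu> (s k)) \<longlonglongrightarrow> l"
      proof (rule tendstoI)
        fix e :: real assume "e > 0"
        then have "\<forall>\<^sub>F k in sequentially. AE x in lebesgue_on \<Omega>. \<bar>s k x - g x\<bar> \<le> e / 2"
          by (intro s(2)) simp
        then show "\<forall>\<^sub>F k in sequentially. dist (ba_step_integral \<Omega> \<mu> (s k)) l < e"
        proof (rule eventually_mono)
          fix k assume "AE x in lebesgue_on \<Omega>. \<bar>s k x - g x\<bar> \<le> e / 2"
          from step[OF s(1) this] show "dist (ba_step_integral \<Omega> \<mu> (s k)) l < e"
            using \<open>e > 0\<close> by (simp add: dist_real_def)
        qed
      qed
      with s(3) show "I = l" by (rule LIMSEQ_unique)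
    next
      obtain s :: "nat \<Rightarrow> 'a \<Rightarrow> real" where s: "\<And>k. simple_function (restrict_space borel \<Omega>) (s k)"
        "\<And>k. AE x in lebesgue_on \<Omega>. \<bar>s k x - g x\<bar> \<le> 1 / real (Suc k)"
        using Linf_simple_approx[OF \<Omega> g] by blast
      have null: "(\<lambda>k. 1 / real (Suc k)) \<longlonglongrightarrow> 0"
        by (rule LIMSEQ_Suc[OF lim_1_over_n])
      have "has_ba_integral \<Omega> \<mu> g l"
        unfolding has_ba_integral_def
      proof (intro exI[of _ s] conjI allI impI s(1))
        fix e :: real assume "e > 0"
        then have "\<forall>\<^sub>F k in sequentially. 1 / real (Suc k) < e"
          by (rule order_tendstoD(2)[OF null])
        then show "\<forall>\<^sub>F k in sequentially. AE x in lebesgue_on \<Omega>. \<bar>s k x - g x\<bar> \<le> e"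
        proof (rule eventually_mono)
          fix k assume "1 / real (Suc k) < e"
          with s(2)[of k] show "AE x in lebesgue_on \<Omega>. \<bar>s k x - g x\<bar> \<le> e"
            by (auto elim!: eventually_mono)
        qed
      next
        have "(\<lambda>k. ba_step_integral \<Omega> \<mu> (s k) - l) \<longlonglongrightarrow> 0"
          using null by (rule Lim_null_comparison[rotated]) (simp add: step[OF s] del: of_nat_Suc)
        then show "(\<lambda>k. ba_step_integral \<Omega> \<mu> (s k)) \<longlonglongrightarrow> l" by (simp only: LIM_zero_iff)
      qed
      then show "has_ba_integral \<Omega> \<mu> g I" if "I = l" using that by simp
    qed
    then show ?thesis using \<open>star \<Omega> g x = l\<close> by (simp add: ba_integral_def)
  qed
  ultimately show thesis by (rule that)
qed

section \<open>Weak convergence and its pointwise consequences\<close>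

theorem proposition5p7:
  fixes \<Omega> :: "(real ^ 'n) set"
    and fs :: "nat \<Rightarrow> real ^ 'n \<Rightarrow> real" and f :: "real ^ 'n \<Rightarrow> real"
  assumes "\<Omega> \<in> sets borel"
    and "Linf_weakly_converges \<Omega> fs f"
  shows "(\<forall>x\<in>Omega_hat \<Omega>. \<forall>dens. dens x \<in> Dens \<Omega> x \<longrightarrow>
            (\<lambda>k. pr \<Omega> dens (fs k) x) \<longlonglongrightarrow> pr \<Omega> dens f x) \<and>
         Omega_zero \<Omega> fs f \<inter> \<Omega> \<in> null_sets lebesgue \<and>
         (AE x in lebesgue. x \<in> Omega_hat \<Omega> - Omega_zero \<Omega> fs f \<longrightarrow>
            (\<lambda>k. star \<Omega> (fs k) x) \<longlonglongrightarrow> star \<Omega> f x)"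
proof (intro conjI ballI allI impI)
  have fs: "fs k \<in> Linf \<Omega>" and f: "f \<in> Linf \<Omega>"
    and weak: "\<mu> \<in> ba \<Omega> \<Longrightarrow> (\<lambda>k. ba_integral \<Omega> \<mu> (fs k)) \<longlonglongrightarrow> ba_integral \<Omega> \<mu> f" for k \<mu>
    using assms(2) by (auto simp: Linf_weakly_converges_def)
  show "(\<lambda>k. pr \<Omega> dens (fs k) x) \<longlonglongrightarrow> pr \<Omega> dens f x" if "dens x \<in> Dens \<Omega> x" for x dens
    using that unfolding pr_def by (intro weak) (simp add: Dens_def)
  let ?N = "\<lambda>g. {x \<in> Omega_hat \<Omega> \<inter> \<Omega>. \<not> star_exists \<Omega> g x}"
  have "negligible (?N f \<union> (\<Union>k. ?N (fs k)))"
    by (intro negligible_Un negligible_Union_nat negligible_not_star_exists assms(1) f fs)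
  \<comment> \<open>If existence of the limit for \<open>fs k\<close> is not eventual at a point, it
    fails there for some \<open>k\<close>, so countably many negligible sets suffice.\<close>
  moreover have "Omega_zero \<Omega> fs f \<inter> \<Omega> \<subseteq> ?N f \<union> (\<Union>k. ?N (fs k))"
    by (auto simp: Omega_zero_def)
  ultimately show "Omega_zero \<Omega> fs f \<inter> \<Omega> \<in> null_sets lebesgue"
    unfolding negligible_iff_null_sets[symmetric] by (rule negligible_subset)
  show "AE x in lebesgue. x \<in> Omega_hat \<Omega> - Omega_zero \<Omega> fs f \<longrightarrow>
            (\<lambda>k. star \<Omega> (fs k) x) \<longlonglongrightarrow> star \<Omega> f x"
  proof (intro AE_I2 impI)
    fix x assume "x \<in> Omega_hat \<Omega> - Omega_zero \<Omega> fs f"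
    then have x: "x \<in> Omega_hat \<Omega>" "star_exists \<Omega> f x" "\<forall>\<^sub>F k in sequentially. star_exists \<Omega> (fs k) x"
      by (auto simp: Omega_zero_def)
    \<comment> \<open>The set function \<open>\<mu>\<close> depends on \<open>x\<close> but not on
      \<open>k\<close>: it represents the values at \<open>x\<close> for \<open>f\<close> and for
      almost all \<open>fs k\<close> together, which is what testing weak convergence
      requires.\<close>
    obtain \<mu> where \<mu>: "\<mu> \<in> ba \<Omega>"
      "\<And>g. g \<in> Linf \<Omega> \<Longrightarrow> star_exists \<Omega> g x \<Longrightarrow> ba_integral \<Omega> \<mu> g = star \<Omega> g x"
      using exists_ba_integral_eq_star[OF assms(1) x(1)] by blast
    have "\<forall>\<^sub>F k in sequentially. ba_integral \<Omega> \<mu> (fs k) = star \<Omega> (fs k) x"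
      using x(3) by (rule eventually_mono) (rule \<mu>(2)[OF fs])
    with weak[OF \<mu>(1)] show "(\<lambda>k. star \<Omega> (fs k) x) \<longlonglongrightarrow> star \<Omega> f x"
      unfolding \<mu>(2)[OF f x(2)] by (rule Lim_transform_eventually)
  qed
qed

end
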